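(* Let $K$ be an algebraically closed field of characteristic zero, let $f\in K[x]$ be a monic polynomial of degree $d\ge 1$, and let $f(x)=(x-\nu)^s g\big((x-\nu)^n\big)$ be its eigenform. Let $G_f=G_f(K)$ be the eigengroup of $f$. 1. If $f(x)=(x-\nu)^d$ has only a single root $\nu\in K$, then $G_f=\{\sigma_{\lambda,(1-\lambda)\nu}\mid\lambda\in K^\times\}\simeq K^\times$ via $\sigma_{\lambda,(1-\lambda)\nu}\mapsto\lambda$, where $\sigma_{\lambda,(1-\lambda)\nu}(x)=\lambda x+(1-\lambda)\nu$. 2. Suppose that $f$ has at least two distinct roots. Then: (a) $G_f\ne\{e\}$ if and only if $n>1$. (b) If $n>1$, then $G_f=\langle\sigma_{\lambda_n,(1-\lambda_n)\nu}\rangle=\{\sigma_{\lambda_n,(1-\lambda_n)\nu}^j\mid 0\le j\le n-1\}$ is the cyclic group of order $n$, where $\lambda_n=e^{2\pi i/n}$ is the primitive $n$-th root of unity and $\sigma_{\lambda_n,(1-\lambda_n)\nu}(x)=\lambda_n x+(1-\lambda_n)\nu$.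
   Context: $K^\times=K\setminus\{0\}$. For $\lambda\in K^\times$, $\mu\in K$, $\sigma_{\lambda,\mu}\in\mathrm{Aut}_K(K[x])$ is the $K$-automorphism with $\sigma_{\lambda,\mu}(x)=\lambda x+\mu$; these are all the elements of $\mathrm{Aut}_K(K[x])$. The eigengroup of $f$ is $G_f(K)=\{\sigma\in\mathrm{Aut}_K(K[x])\mid\sigma(f)=cf\text{ for some }c\in K\}$. The symbol $e^{2\pi i/n}$ denotes a fixed primitive $n$-th root of unity in $K$. Exponent: for a monic polynomial $h(x)=\sum_i a_ix^i$, $\gcd(h(x)):=\gcd\{i\ge1\mid a_i\ne0\}$ (the leading coefficient is included; the gcd of the empty set, occurring when $h=1$, is $0$). Eigenform: for a monic polynomial $f(x)=x^d+a_{d-1}x^{d-1}+\cdots+a_0$ of degree $d\ge1$, the eigenform is the unique presentation $f(x)=(x-\nu)^s g\big((x-\nu)^n\big)$ where $\nu:=-\frac{a_{d-1}}{d}$; $s\ge0$ is the multiplicity of $\nu$ as a root of $f$ ($s=0$ if $\nu$ is not a root); $n:=\gcd\big(f(x+\nu)/x^s\big)$; and $g(x)$ is a monic polynomial such that $d=s+n\deg(g(x))$. If $f(x)=(x-\nu')^d$ has a single root then, by convention, $\nu=\nu'$, $s=d$, $n=0$, $g=1$. *)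

theory Defs
  imports "HOL-Algebra.Algebraic_Closure_Type" "HOL-Algebra.Elementary_Groups"
begin

text \<open>The group $\mathrm{Aut}_K(K[x])$ of $K$-algebra automorphisms of $K[x]$ under composition,
  where $K$ is the coefficient type.\<close>

definition poly_auts :: "('a::field poly \<Rightarrow> 'a poly) set" where
  "poly_auts = {\<sigma> \<in> ring_iso ring_of_type_algebra ring_of_type_algebra. \<forall>c. \<sigma> [:c:] = [:c:]}"

definition Aut_poly :: "('a::field poly \<Rightarrow> 'a poly) monoid" where
  "Aut_poly = \<lparr>carrier = poly_auts, monoid.mult = (\<circ>), one = id\<rparr>"

text \<open>A $K$-automorphism with $\sigma(x) = \lambda x + \mu$ must send $p(x)$ to
  $p(\lambda x + \mu)$; see \<open>aff_sigma_unique\<close> below.\<close>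

definition aff_sigma :: "'a::field \<Rightarrow> 'a \<Rightarrow> 'a poly \<Rightarrow> 'a poly" where
  "aff_sigma l m p = pcompose p [:m, l:]"

definition eigengroup :: "'a::field poly \<Rightarrow> ('a poly \<Rightarrow> 'a poly) monoid" where
  "eigengroup f = Aut_poly\<lparr>carrier := {\<sigma> \<in> poly_auts. \<exists>c. \<sigma> f = smult c f}\<rparr>"

abbreviation mult_group :: "'a::field monoid" where
  "mult_group \<equiv> mult_of ring_of_type_algebra"

definition exponent_gcd :: "'a::zero poly \<Rightarrow> nat" where
  "exponent_gcd h = Gcd {i. 1 \<le> i \<and> Polynomial.coeff h i \<noteq> 0}"

text \<open>The case distinction is the convention for a single root: the general formulas also give
  $s = d$ and $n = 0$ there, but $g((x-\nu)^0)$ only involves $g(1)$ and does not determine $g$.\<close>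

definition is_eigenform ::
  "'a::field_char_0 poly \<Rightarrow> 'a \<Rightarrow> nat \<Rightarrow> nat \<Rightarrow> 'a poly \<Rightarrow> bool" where
  "is_eigenform f \<nu> s n g \<longleftrightarrow>
     (if \<exists>\<nu>'. f = [:- \<nu>', 1:] ^ Polynomial.degree f
      then f = [:- \<nu>, 1:] ^ Polynomial.degree f \<and> s = Polynomial.degree f \<and> n = 0 \<and> g = 1
      else \<nu> = - Polynomial.coeff f (Polynomial.degree f - 1) / of_nat (Polynomial.degree f)
         \<and> s = Polynomial.order \<nu> f
         \<and> n = exponent_gcd (pcompose f [:\<nu>, 1:] div [:0, 1:] ^ s)
         \<and> Polynomial.lead_coeff g = 1
         \<and> Polynomial.degree f = s + n * Polynomial.degree g
         \<and> f = [:- \<nu>, 1:] ^ s * pcompose g ([:- \<nu>, 1:] ^ n))"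

definition primitive_root_of_unity :: "nat \<Rightarrow> 'a::field \<Rightarrow> bool" where
  "primitive_root_of_unity n z \<longleftrightarrow> 0 < n \<and> z ^ n = 1 \<and> (\<forall>k. 0 < k \<and> k < n \<longrightarrow> z ^ k \<noteq> 1)"

lemma poly_auts_iff:
  "\<sigma> \<in> poly_auts \<longleftrightarrow> bij \<sigma> \<and> (\<forall>p q. \<sigma> (p + q) = \<sigma> p + \<sigma> q) \<and>
     (\<forall>p q. \<sigma> (p * q) = \<sigma> p * \<sigma> q) \<and> (\<forall>c. \<sigma> [:c:] = [:c:])"
proof -
  have "\<sigma> 1 = 1" if "\<forall>c. \<sigma> [:c:] = [:c:]"
    using that by (metis one_pCons)
  then show ?thesis
    unfolding poly_auts_def ring_iso_def ring_hom_def ring_of_type_algebra_def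
    by (auto simp: bij_betw_def)
qed

lemma group_Aut_poly: "group (Aut_poly :: ('a::field poly \<Rightarrow> 'a poly) monoid)"
proof (rule groupI, goal_cases)
  case (1 x y)
  then show ?case
    by (auto simp: Aut_poly_def poly_auts_iff bij_comp)
next
  case 2
  then show ?case
    by (auto simp: Aut_poly_def poly_auts_iff)
next
  case (3 x y z)
  then show ?case
    by (simp add: Aut_poly_def comp_assoc)
next
  case (4 x)
  then show ?case
    by (simp add: Aut_poly_def)
next
  case (5 x)
  then have x: "bij x" "\<And>p q. x (p + q) = x p + x q" "\<And>p q. x (p * q) = x p * x q"
      "\<And>c. x [:c:] = [:c:]"
    by (auto simp: Aut_poly_def poly_auts_iff)
  have i: "inv_into UNIV x (x p) = p" "x (inv_into UNIV x p) = p" for p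
    using x(1) by (simp_all add: bij_is_inj bij_is_surj surj_f_inv_f)
  have "inv_into UNIV x \<in> poly_auts"
    unfolding poly_auts_iff using bij_imp_bij_inv[OF x(1)] i x by metis
  moreover have "inv_into UNIV x \<circ> x = id"
    using i by auto
  ultimately show ?case
    by (auto simp: Aut_poly_def)
qed

lemma aff_sigma_comp:
  "aff_sigma l m \<circ> aff_sigma l' m' = aff_sigma (l * l') (l' * m + m')"
  by (auto simp: fun_eq_iff aff_sigma_def pcompose_pCons algebra_simps simp flip: pcompose_assoc)

lemma aff_sigma_in_poly_auts:
  assumes "l \<noteq> 0"
  shows "aff_sigma l m \<in> poly_auts"
proof -
  have "aff_sigma 1 0 = id"
    by (auto simp: fun_eq_iff aff_sigma_def)
  then have "aff_sigma l m \<circ> aff_sigma (1 / l) (- m / l) = id"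
      "aff_sigma (1 / l) (- m / l) \<circ> aff_sigma l m = id"
    using assms by (simp_all add: aff_sigma_comp)
  then have "bij (aff_sigma l m)"
    using o_bij by blast
  then show ?thesis
    by (auto simp: poly_auts_iff aff_sigma_def pcompose_add pcompose_mult pcompose_pCons)
qed

lemma aff_sigma_unique:
  assumes "l \<noteq> 0"
  shows "\<sigma> \<in> poly_auts \<and> \<sigma> [:0, 1:] = [:m, l:] \<longleftrightarrow> \<sigma> = aff_sigma l m"
proof
  assume *: "\<sigma> \<in> poly_auts \<and> \<sigma> [:0, 1:] = [:m, l:]"
  have "\<sigma> p = aff_sigma l m p" for p
  proof (induction p)
    case 0
    then show ?case
      using * unfolding poly_auts_iff aff_sigma_def by (metis pCons_0_0 pcompose_0)
  next
    case (pCons a p)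
    have "pCons a p = [:a:] + [:0, 1:] * p"
      by simp
    then have "\<sigma> (pCons a p) = [:a:] + [:m, l:] * \<sigma> p"
      using * unfolding poly_auts_iff by metis
    then show ?case
      using pCons by (simp add: aff_sigma_def pcompose_pCons)
  qed
  then show "\<sigma> = aff_sigma l m"
    by blast
qed (auto simp: aff_sigma_in_poly_auts[OF assms], simp add: aff_sigma_def pcompose_pCons)

lemma subgroup_eigengroup:
  "subgroup (carrier (eigengroup f)) (Aut_poly :: ('a::field poly \<Rightarrow> 'a poly) monoid)"
proof -
  interpret group "Aut_poly :: ('a poly \<Rightarrow> 'a poly) monoid"
    by (rule group_Aut_poly)
  have smult: "\<sigma> (smult c p) = smult c (\<sigma> p)" if "\<sigma> \<in> poly_auts" for \<sigma> :: "'a poly \<Rightarrow> 'a poly" and c p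
  proof -
    have "\<sigma> ([:c:] * p) = [:c:] * \<sigma> p"
      using that unfolding poly_auts_iff by metis
    then show ?thesis
      by simp
  qed
  have zero: "\<sigma> 0 = 0" if "\<sigma> \<in> poly_auts" for \<sigma> :: "'a poly \<Rightarrow> 'a poly"
    using smult[OF that, of 0] by simp
  show ?thesis
  proof (rule subgroupI, goal_cases)
    case 1
    then show ?case
      by (auto simp: eigengroup_def Aut_poly_def)
  next
    case 2
    have "id \<in> carrier (eigengroup f)"
      using one_closed by (auto simp: eigengroup_def Aut_poly_def intro: exI[of _ 1])
    then show ?case
      by blast
  next
    case (3 \<sigma>)
    then obtain c where c: "\<sigma> \<in> poly_auts" "\<sigma> f = smult c f"
      by (auto simp: eigengroup_def)
    then have \<sigma>: "\<sigma> \<in> carrier Aut_poly"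
      by (simp add: Aut_poly_def)
    define \<tau> where "\<tau> = inv\<^bsub>Aut_poly\<^esub> \<sigma>"
    have \<tau>: "\<tau> \<in> poly_auts" "\<tau> \<circ> \<sigma> = id"
      using inv_closed[OF \<sigma>] l_inv[OF \<sigma>] by (simp_all add: Aut_poly_def \<tau>_def)
    have "f = smult c (\<tau> f)"
      using \<tau> c smult[OF \<tau>(1), of c f] by (metis comp_apply id_apply)
    then have "\<tau> f = smult (1 / c) f"
      using zero[OF \<tau>(1)] by (cases "c = 0") (auto, metis left_inverse smult_1_left smult_smult inverse_eq_divide)
    then show ?case
      using \<tau>(1) by (auto simp: eigengroup_def \<tau>_def)
  next
    case (4 \<sigma> \<tau>)
    then obtain c d where "\<sigma> \<in> poly_auts" "\<sigma> f = smult c f" "\<tau> \<in> poly_auts" "\<tau> f = smult d f"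
      by (auto simp: eigengroup_def)
    moreover from this have "\<sigma> \<circ> \<tau> \<in> poly_auts"
      using m_closed[of \<sigma> \<tau>] by (simp add: Aut_poly_def)
    ultimately show ?case
      by (auto simp: eigengroup_def Aut_poly_def smult)
  qed
qed

lemma pcompose_power': "pcompose (p ^ k) q = pcompose p q ^ k"
  for p q :: "'a::comm_ring_1 poly"
  by (induction k) (auto simp: pcompose_mult pcompose_1)

lemma pcompose_X_pow:
  fixes h :: "'a::field poly"
  assumes "\<And>i. Polynomial.coeff h i \<noteq> 0 \<Longrightarrow> n dvd i" and "0 < n"
  obtains g where "h = pcompose g ([:0, 1:] ^ n)"
proof
  define A where "A = {..Polynomial.degree h}"
  define S where "S = {i \<in> A. n dvd i}"
  let ?g = "\<Sum>i\<in>S. Polynomial.monom (Polynomial.coeff h i) (i div n)"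
  have "pcompose ?g ([:0, 1:] ^ n) = (\<Sum>i\<in>S. Polynomial.monom (Polynomial.coeff h i) i)"
    unfolding pcompose_sum
  proof (rule sum.cong)
    fix i assume "i \<in> S"
    then have "n * (i div n) = i"
      by (simp add: S_def)
    then show "pcompose (Polynomial.monom (Polynomial.coeff h i) (i div n)) ([:0, 1:] ^ n)
        = Polynomial.monom (Polynomial.coeff h i) i"
      by (simp add: monom_altdef pcompose_smult pcompose_power' pcompose_pCons pcompose_1
          flip: power_mult)
  qed simp
  also have "\<dots> = (\<Sum>i\<in>A. Polynomial.monom (Polynomial.coeff h i) i)"
    by (rule sum.mono_neutral_left) (use assms in \<open>auto simp: A_def S_def\<close>)
  also have "\<dots> = h"
    using poly_as_sum_of_monoms[of h] by (simp add: A_def)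
  finally show "h = pcompose ?g ([:0, 1:] ^ n)" ..
qed

lemma eigenform_exists_unique:
  fixes f :: "'a::field_char_0 poly"
  assumes "Polynomial.lead_coeff f = 1" and "1 \<le> Polynomial.degree f"
  shows "\<exists>!(\<nu>, s, n, g). is_eigenform f \<nu> s n g"
proof (cases "\<exists>\<nu>'. f = [:- \<nu>', 1:] ^ Polynomial.degree f")
  case True
  then obtain \<nu>' where \<nu>': "f = [:- \<nu>', 1:] ^ Polynomial.degree f"
    by blast
  have uniq: "\<nu> = \<nu>'" if "f = [:- \<nu>, 1:] ^ Polynomial.degree f" for \<nu>
  proof -
    have "poly f \<nu> = 0"
      by (subst that) (use assms in \<open>simp add: poly_power\<close>)
    moreover have "poly f \<nu> = (\<nu> - \<nu>') ^ Polynomial.degree f"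
      by (subst \<nu>') (simp add: poly_power)
    ultimately show ?thesis
      by simp
  qed
  show ?thesis
  proof (rule ex1I[of _ "(\<nu>', Polynomial.degree f, 0, 1)"])
    show "case (\<nu>', Polynomial.degree f, 0, 1) of (\<nu>, s, n, g) \<Rightarrow> is_eigenform f \<nu> s n g"
      unfolding is_eigenform_def prod.case if_P[OF True] using \<nu>' by blast
  next
    fix t :: "'a \<times> nat \<times> nat \<times> 'a poly"
    assume "case t of (\<nu>, s, n, g) \<Rightarrow> is_eigenform f \<nu> s n g"
    then show "t = (\<nu>', Polynomial.degree f, 0, 1)"
      unfolding is_eigenform_def if_P[OF True] using uniq by (cases t) blast
  qed
next
  case False
  define \<nu> where "\<nu> = - Polynomial.coeff f (Polynomial.degree f - 1) / of_nat (Polynomial.degree f)"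
  define s where "s = Polynomial.order \<nu> f"
  define F where "F = pcompose f [:\<nu>, 1:]"
  define h where "h = F div [:0, 1:] ^ s"
  define n where "n = exponent_gcd h"
  have "f \<noteq> 0"
    using assms by auto
  then obtain q where q: "f = [:- \<nu>, 1:] ^ s * q" "\<not> [:- \<nu>, 1:] dvd q"
    unfolding s_def using order_decomp by blast
  have "q \<noteq> 0"
    using q(2) by auto
  have h: "h = pcompose q [:\<nu>, 1:]"
    unfolding h_def F_def
    by (subst q(1)) (simp add: pcompose_mult pcompose_power' pcompose_pCons)
  have q_h: "q = pcompose h [:- \<nu>, 1:]"
    by (simp add: h pcompose_assoc[symmetric] pcompose_pCons)
  have lead: "Polynomial.lead_coeff q = 1"
    using assms(1) unfolding q(1) by (simp add: lead_coeff_mult lead_coeff_power)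
  have deg: "Polynomial.degree f = s + Polynomial.degree q"
    using \<open>q \<noteq> 0\<close> by (subst q(1)) (simp add: degree_mult_eq degree_power_eq)
  have "Polynomial.degree q \<noteq> 0"
  proof
    assume "Polynomial.degree q = 0"
    then have "q = 1"
      using lead by (metis degree_eq_zeroE coeff_pCons_0 one_pCons)
    with q(1) deg have "f = [:- \<nu>, 1:] ^ Polynomial.degree f"
      by simp
    with False show False
      by blast
  qed
  have deg_h: "Polynomial.degree h = Polynomial.degree q"
    by (simp add: h degree_pcompose)
  have "Polynomial.coeff h (Polynomial.degree h) \<noteq> 0"
    using \<open>Polynomial.degree q \<noteq> 0\<close> deg_h leading_coeff_0_iff[of h] by (metis degree_0)
  then have "n dvd Polynomial.degree h"
    unfolding n_def exponent_gcd_def using \<open>Polynomial.degree q \<noteq> 0\<close> deg_h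
    by (intro Gcd_dvd) auto
  then have "0 < n"
    using \<open>Polynomial.degree q \<noteq> 0\<close> deg_h by (cases n) auto
  have "n dvd i" if "Polynomial.coeff h i \<noteq> 0" for i
    using that unfolding n_def exponent_gcd_def by (cases "i = 0") (auto intro: Gcd_dvd)
  then obtain g where g: "h = pcompose g ([:0, 1:] ^ n)"
    using pcompose_X_pow \<open>0 < n\<close> by blast
  have q_g: "q = pcompose g ([:- \<nu>, 1:] ^ n)"
    by (simp add: q_h g pcompose_assoc[symmetric] pcompose_power' pcompose_pCons)
  have deg_pow: "Polynomial.degree ([:- \<nu>, 1:] ^ n) = n"
    by (simp add: degree_power_eq)
  have lead_pow: "Polynomial.lead_coeff ([:- \<nu>, 1:] ^ n) = 1"
    by (simp only: lead_coeff_power) simp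
  have "Polynomial.lead_coeff q = Polynomial.lead_coeff g"
    unfolding q_g by (subst lead_coeff_comp) (use \<open>0 < n\<close> deg_pow lead_pow in auto)
  then have lead_g: "Polynomial.lead_coeff g = 1"
    using lead by simp
  have deg_g: "Polynomial.degree f = s + n * Polynomial.degree g"
    unfolding deg q_g by (simp add: degree_pcompose deg_pow)
  have uniq: "g' = g" if "f = [:- \<nu>, 1:] ^ s * pcompose g' ([:- \<nu>, 1:] ^ n)" for g'
  proof -
    have "pcompose g' ([:- \<nu>, 1:] ^ n) = pcompose g ([:- \<nu>, 1:] ^ n)"
      using that q(1) q_g by simp
    then have "pcompose (g' - g) ([:- \<nu>, 1:] ^ n) = 0"
      by (simp add: pcompose_diff)
    then have "g' - g = 0"
      by (rule pcompose_eq_0) (use \<open>0 < n\<close> deg_pow in simp)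
    then show ?thesis
      by simp
  qed
  have eq: "is_eigenform f \<nu>' s' n' g' \<longleftrightarrow> \<nu>' = \<nu> \<and> s' = s \<and> n' = n \<and> g' = g" for \<nu>' s' n' g'
    unfolding is_eigenform_def if_not_P[OF False] \<nu>_def[symmetric]
    using lead_g deg_g uniq q(1) q_g s_def n_def h_def F_def by metis
  show ?thesis
    by (rule ex1I[of _ "(\<nu>, s, n, g)"]) (auto simp: eq)
qed

lemma primitive_root_of_unity_dvd_iff:
  assumes "primitive_root_of_unity n z"
  shows "z ^ k = 1 \<longleftrightarrow> n dvd k"
proof -
  have n: "0 < n" "z ^ n = 1" "\<And>k. 0 < k \<Longrightarrow> k < n \<Longrightarrow> z ^ k \<noteq> 1"
    using assms by (auto simp: primitive_root_of_unity_def)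
  have "z ^ k = z ^ (n * (k div n) + k mod n)"
    by simp
  also have "\<dots> = z ^ (k mod n)"
    unfolding power_add power_mult using n(2) by simp
  finally have "z ^ k = z ^ (k mod n)" .
  then show ?thesis
    using n(1) n(3)[of "k mod n"] by (cases "k mod n = 0") (auto simp: dvd_eq_mod_eq_0)
qed

lemma primitive_root_of_unityI:
  assumes "0 < n" "\<And>k. z ^ k = 1 \<longleftrightarrow> n dvd k"
  shows "primitive_root_of_unity n z"
  using assms by (auto simp: primitive_root_of_unity_def dest: dvd_imp_le)

lemma primitive_root_of_unity_exists:
  assumes "0 < n"
  shows "\<exists>z :: 'a::{alg_closed_field, field_char_0}. primitive_root_of_unity n z"
  using assms
proof (induction n rule: prime_divisors_induct)
  case zero
  then show ?case by simp
next
  case (unit x)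
  then show ?case
    by (auto simp: primitive_root_of_unity_def intro!: exI[of _ 1])
next
  case (factor p m)
  then obtain z :: 'a where z: "primitive_root_of_unity m z" and "0 < m"
    by auto
  note z_iff = primitive_root_of_unity_dvd_iff[OF z]
  have p: "prime p" "1 < p"
    using factor(1) prime_gt_1_nat by blast+
  show ?case
  proof (cases "p dvd m")
    case True
    obtain w where w: "w ^ p = z"
      using nth_root_exists[of p z] p by auto
    have "w ^ k = 1 \<longleftrightarrow> p * m dvd k" for k
    proof
      assume "w ^ k = 1"
      then have "z ^ k = 1"
        by (metis w power_commutes power_mult mult.commute power_one)
      then have "p dvd k"
        using True z_iff by auto
      then obtain j where j: "k = p * j" ..
      with \<open>w ^ k = 1\<close> have "z ^ j = 1"
        by (simp add: power_mult w)
      then show "p * m dvd k"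
        using z_iff j by simp
    next
      assume "p * m dvd k"
      then obtain j where "k = p * m * j" ..
      then show "w ^ k = 1"
        using z_iff[of m] by (simp add: power_mult w)
    qed
    then show ?thesis
      using primitive_root_of_unityI[of "p * m" w] \<open>0 < m\<close> p by auto
  next
    case False
    let ?q = "\<Sum>i<p. Polynomial.monom (1::'a) i"
    have "Polynomial.coeff ?q (p - 1) = 1"
      using p by (simp add: coeff_sum)
    then have "Polynomial.degree ?q > 0"
      using le_degree[of ?q "p - 1"] p by simp
    then obtain w where "poly ?q w = 0"
      using alg_closed_imp_poly_has_root by blast
    then have w0: "(\<Sum>i<p. w ^ i) = 0"
      by (simp add: poly_sum poly_monom)
    have "w \<noteq> 1"
      using w0 p by auto
    have "w ^ p = 1"
      using w0 power_diff_1_eq[of w p] by simp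
    have w_iff: "w ^ k = 1 \<longleftrightarrow> p dvd k" for k
    proof
      assume k: "w ^ k = 1"
      show "p dvd k"
      proof (rule ccontr)
        assume "\<not> p dvd k"
        then have "coprime k p"
          using p prime_imp_coprime coprime_commute by blast
        moreover have "k \<noteq> 0"
          using \<open>\<not> p dvd k\<close> by (metis dvd_0_right)
        ultimately obtain x y where "k * x = p * y + 1"
          using bezout_nat[of k p] by (auto simp: coprime_iff_gcd_eq_1)
        then have "w ^ (k * x) = w ^ (p * y) * w"
          by simp
        then show False
          using k \<open>w ^ p = 1\<close> \<open>w \<noteq> 1\<close> by (simp add: power_mult)
      qed
    qed (use \<open>w ^ p = 1\<close> in \<open>auto simp: power_mult\<close>)
    have cop: "coprime p m"
      using False p by (simp add: prime_imp_coprime)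
    have "(z * w) ^ k = 1 \<longleftrightarrow> p * m dvd k" for k
    proof
      assume k: "(z * w) ^ k = 1"
      have "z ^ (k * p) = (z * w) ^ (k * p)"
        using w_iff[of "k * p"] by (simp add: power_mult_distrib)
      then have "z ^ (k * p) = 1"
        using k by (simp add: power_mult)
      then have "m dvd k"
        using cop z_iff by (simp add: coprime_commute coprime_dvd_mult_left_iff)
      then have "w ^ k = 1"
        using k z_iff[of k] by (simp add: power_mult_distrib)
      then show "p * m dvd k"
        using w_iff cop \<open>m dvd k\<close> by (simp add: divides_mult)
    next
      assume "p * m dvd k"
      then have "m dvd k" "p dvd k"
        using dvd_mult_left dvd_mult_right by blast+
      then show "(z * w) ^ k = 1"
        using z_iff[of k] w_iff[of k] by (simp add: power_mult_distrib)
    qed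
    then show ?thesis
      using primitive_root_of_unityI[of "p * m" "z * w"] \<open>0 < m\<close> p by auto
  qed
qed

end

theory Submission
  imports Defs
begin

text \<open>A $K$-automorphism of $K[x]$ is an affine substitution $x \mapsto \lambda x + \mu$. If
  $\sigma_{\lambda,\mu}$ scales $f$, it scales (with other constants) all derivatives of $f$,
  hence the linear polynomial $f^{(d-1)}$, whose root is $\nu$; this forces
  $\mu = (1 - \lambda)\nu$. After moving $\nu$ to the origin, $f$ becomes $x^s h(x)$ with
  $h(0) \ne 0$, and comparing coefficients shows that $x \mapsto \lambda x$ scales it if and only if
  $\lambda^i = 1$ for all exponents $i$ of $h$, that is $\lambda^n = 1$.\<close>

section \<open>Affine substitutions and the automorphisms of K[x]\<close>

lemma aff_sigma_X: "aff_sigma l m [:0, 1:] = [:m, l:]"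
  by (simp add: aff_sigma_def pcompose_pCons)

lemma aff_sigma_inject: "aff_sigma l m = aff_sigma l' m' \<longleftrightarrow> l = l' \<and> m = m'"
  by (metis aff_sigma_X pCons_eq_iff)

lemma aff_sigma_1_0: "aff_sigma 1 0 = id"
  by (auto simp: fun_eq_iff aff_sigma_def)

text \<open>The substitution x -> l x + (1 - l) \<nu> is the homothety of ratio l that fixes \<nu>;
  homotheties with a common centre compose by multiplying their ratios.\<close>

lemma aff_sigma_about_comp:
  "aff_sigma k ((1 - k) * \<nu>) \<circ> aff_sigma l ((1 - l) * \<nu>) = aff_sigma (k * l) ((1 - k * l) * \<nu>)"
  by (simp add: aff_sigma_comp aff_sigma_inject algebra_simps)

lemma aff_sigma_about_pow:
  "aff_sigma z ((1 - z) * \<nu>) [^]\<^bsub>Aut_poly\<^esub> (j :: nat) = aff_sigma (z ^ j) ((1 - z ^ j) * \<nu>)"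
proof (induction j)
  case 0
  then show ?case
    by (simp add: Aut_poly_def aff_sigma_1_0)
next
  case (Suc j)
  then show ?case
    using aff_sigma_about_comp[of "z ^ j" \<nu> z] by (simp add: Aut_poly_def mult.commute)
qed

text \<open>Conjugation by the translation x -> x + \<nu> moves the centre \<nu> to the origin,
  where the homothety becomes x -> l x.\<close>

lemma aff_sigma_about_translate:
  "pcompose (aff_sigma l ((1 - l) * \<nu>) p) [:\<nu>, 1:] = pcompose (pcompose p [:\<nu>, 1:]) [:0, l:]"
proof -
  have "aff_sigma 1 \<nu> \<circ> aff_sigma l ((1 - l) * \<nu>) = aff_sigma l 0 \<circ> aff_sigma 1 \<nu>"
    by (simp add: aff_sigma_comp aff_sigma_inject algebra_simps)
  then show ?thesis
    by (simp add: fun_eq_iff aff_sigma_def)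
qed

lemma aff_sigma_about_power:
  "aff_sigma l ((1 - l) * \<nu>) ([:- \<nu>, 1:] ^ k) = smult (l ^ k) ([:- \<nu>, 1:] ^ k)"
proof -
  have "pcompose [:- \<nu>, 1:] [:(1 - l) * \<nu>, l:] = smult l [:- \<nu>, 1:]"
    by (simp add: pcompose_pCons algebra_simps)
  then show ?thesis
    by (simp only: aff_sigma_def pcompose_power' smult_power)
qed

text \<open>An automorphism substitutes the image of x for x. By surjectivity x itself arises from
  such a substitution, and since degrees multiply, the image of x must have degree 1.\<close>

lemma poly_auts_eq: "poly_auts = {aff_sigma l m | l m. l \<noteq> 0}"
proof (intro equalityI subsetI)
  fix \<sigma> :: "'a poly \<Rightarrow> 'a poly"
  assume \<sigma>: "\<sigma> \<in> poly_auts"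
  have subst: "\<sigma> p = pcompose p (\<sigma> [:0, 1:])" for p
  proof (induction p)
    case 0
    then show ?case
      using \<sigma> unfolding poly_auts_iff by (metis pCons_0_0 pcompose_0)
  next
    case (pCons a p)
    have "pCons a p = [:a:] + [:0, 1:] * p"
      by simp
    then have "\<sigma> (pCons a p) = [:a:] + \<sigma> [:0, 1:] * \<sigma> p"
      using \<sigma> unfolding poly_auts_iff by metis
    then show ?case
      using pCons by (simp add: pcompose_pCons)
  qed
  obtain p where "\<sigma> p = [:0, 1:]"
    using \<sigma> unfolding poly_auts_iff by (metis bij_pointE)
  then have "Polynomial.degree p * Polynomial.degree (\<sigma> [:0, 1:]) = 1"
    using subst[of p] by (metis degree_pcompose degree_pCons_eq_if degree_0 one_neq_zero pCons_eq_0_iff One_nat_def)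
  then have deg: "Polynomial.degree (\<sigma> [:0, 1:]) = 1"
    by simp
  then obtain m l where ml: "\<sigma> [:0, 1:] = [:m, l:]"
    using degree1_coeffs by blast
  then have "l \<noteq> 0"
    using deg by auto
  then show "\<sigma> \<in> {aff_sigma l m | l m. l \<noteq> 0}"
    using aff_sigma_unique \<sigma> ml by blast
qed (use aff_sigma_in_poly_auts in blast)

lemma carrier_eigengroup:
  "carrier (eigengroup f) = {aff_sigma l m | l m. l \<noteq> 0 \<and> (\<exists>c. aff_sigma l m f = smult c f)}"
  unfolding eigengroup_def poly_auts_eq by auto

section \<open>The point fixed by an eigen-substitution\<close>

text \<open>Induction on the degree through \<open>pderiv f\<close>, which satisfies the same kind
  of equation with the same \<open>l\<close> and \<open>m\<close>. The quotient on the right is the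
  mean of the roots and is unchanged by differentiation. The leading coefficient appears in it
  because derivatives of monic polynomials are not monic.\<close>

lemma aff_sigma_eigen_fixes:
  fixes f :: "'a::field_char_0 poly"
  assumes "l \<noteq> 0" and "0 < Polynomial.degree f" and "aff_sigma l m f = smult c f"
  shows "m = (1 - l) * (- Polynomial.coeff f (Polynomial.degree f - 1)
    / (of_nat (Polynomial.degree f) * Polynomial.lead_coeff f))"
proof -
  obtain k where "Polynomial.degree f = Suc k"
    using assms(2) gr0_conv_Suc by blast
  then show ?thesis
    using assms(3)
  proof (induction k arbitrary: f c)
    case 0
    then obtain b a where f: "f = [:b, a:]"
      by (metis One_nat_def degree1_coeffs)
    with 0 have "a \<noteq> 0"
      by auto
    \<comment> \<open>The leading coefficients force c = l; the constant ones then say that x -> l x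
      + m fixes the root -b/a.\<close>
    have "b + m * a = c * b" "l * a = c * a"
      using 0(2) by (auto simp: f aff_sigma_def pcompose_pCons algebra_simps)
    then have "b + m * a = l * b"
      using \<open>a \<noteq> 0\<close> by simp
    then show ?case
      using \<open>a \<noteq> 0\<close> by (simp add: f field_simps)
  next
    case (Suc k)
    have deg: "Polynomial.degree (pderiv f) = Suc k"
      using Suc.prems(1) by (simp add: degree_pderiv)
    \<comment> \<open>By the chain rule, differentiation lowers the eigenvalue from c to c /
      l.\<close>
    have "smult l (aff_sigma l m (pderiv f)) = pderiv (aff_sigma l m f)"
      by (simp add: aff_sigma_def pderiv_pcompose pderiv_pCons)
    also have "\<dots> = smult c (pderiv f)"
      by (simp add: Suc.prems(2) pderiv_smult)
    finally have "aff_sigma l m (pderiv f) = smult (c / l) (pderiv f)"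
      using \<open>l \<noteq> 0\<close> by (metis divide_inverse_commute left_inverse smult_1_left smult_smult)
    note IH = Suc.IH[OF deg this]
    have "Polynomial.lead_coeff f \<noteq> 0"
      using Suc.prems(1) by (metis degree_0 leading_coeff_0_iff old.nat.distinct(1))
    then have nz: "Polynomial.coeff f (Suc (Suc k)) \<noteq> 0"
      using Suc.prems(1) by simp
    \<comment> \<open>These are the degrees of \<open>f\<close> and \<open>pderiv f\<close>; being
      nonzero in characteristic zero, they cancel when the two quotients are compared.\<close>
    have "(2 + of_nat k :: 'a) \<noteq> 0" "(1 + of_nat k :: 'a) \<noteq> 0"
      using of_nat_neq_0[of "Suc k", where 'a = 'a] of_nat_neq_0[of k, where 'a = 'a] by (simp_all add: add.commute add.assoc)
    then show ?case
      using IH nz by (simp add: deg Suc.prems(1) coeff_pderiv divide_simps)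
  qed
qed

section \<open>Exponents and roots of unity\<close>

text \<open>If some positive power of x is 1, all elements of S are multiples of the least such
  exponent, hence so is their gcd. Otherwise S contains at most 0, and its \<open>Gcd\<close> is
  0.\<close>

lemma power_Gcd_eq_1:
  fixes x :: "'a::field" and S :: "nat set"
  assumes "\<And>i. i \<in> S \<Longrightarrow> x ^ i = 1"
  shows "x ^ Gcd S = 1"
proof (cases "\<exists>i>0. x ^ i = 1")
  case True
  define m where "m = (LEAST i. 0 < i \<and> x ^ i = 1)"
  have "primitive_root_of_unity m x"
    unfolding primitive_root_of_unity_def m_def
    using LeastI_ex[OF True] not_less_Least by blast
  then show ?thesis
    using assms primitive_root_of_unity_dvd_iff Gcd_greatest by metis
next
  case False
  then have "S \<subseteq> {0}"
    using assms by auto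
  then have "Gcd S = 0"
    by (simp only: Gcd_0_iff)
  then show ?thesis
    by (simp only: power_0)
qed

lemma homothety_eigen_imp_power_exponent_gcd:
  fixes h :: "'a::field poly"
  assumes "Polynomial.coeff h 0 \<noteq> 0" and "l \<noteq> 0"
    and "pcompose ([:0, 1:] ^ s * h) [:0, l:] = smult c ([:0, 1:] ^ s * h)"
  shows "l ^ exponent_gcd h = 1"
proof -
  have X: "[:0, 1:] ^ s = Polynomial.monom (1::'a) s"
    by (simp add: monom_altdef)
  have "l ^ (s + i) * Polynomial.coeff h i = c * Polynomial.coeff h i" for i
    using arg_cong[OF assms(3), of "\<lambda>p. Polynomial.coeff p (s + i)"]
    by (simp add: coeff_pcompose_linear X coeff_monom_mult)
  \<comment> \<open>Since h(0) is nonzero, the index 0 identifies c as \<open>l ^ s\<close>;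
    substituting this removes c from all other equations.\<close>
  from this[of 0] this have "l ^ s * (l ^ i * Polynomial.coeff h i) = l ^ s * Polynomial.coeff h i" for i
    using assms(1) by (simp add: power_add mult.assoc)
  then have "l ^ i = 1" if "Polynomial.coeff h i \<noteq> 0" for i
    using that \<open>l \<noteq> 0\<close> by (metis mult_cancel_left mult_cancel_right2 power_not_zero)
  then show ?thesis
    unfolding exponent_gcd_def by (intro power_Gcd_eq_1) auto
qed

text \<open>The n powers of z are distinct roots of x^n - 1, which has at most n roots, so they
  exhaust them.\<close>

lemma roots_of_unity_eq_powers:
  fixes z :: "'a::field"
  assumes "primitive_root_of_unity n z"
  shows "{l. l ^ n = 1} = (\<lambda>j. z ^ j) ` {..<n}" and "inj_on (\<lambda>j. z ^ j) {..<n}"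
proof -
  have n: "0 < n" "z ^ n = 1"
    using assms by (auto simp: primitive_root_of_unity_def)
  then have "z \<noteq> 0"
    by (auto simp: power_0_left)
  have le: "i \<ge> j" if "z ^ i = z ^ j" "j < n" for i j
  proof (rule ccontr)
    assume "\<not> j \<le> i"
    then have "z ^ j = z ^ i * z ^ (j - i)"
      by (simp flip: power_add)
    then have "z ^ (j - i) = 1"
      using that(1) \<open>z \<noteq> 0\<close> by simp
    then show False
      using assms \<open>\<not> j \<le> i\<close> \<open>j < n\<close> unfolding primitive_root_of_unity_def
      by (metis less_imp_diff_less not_le zero_less_diff)
  qed
  show inj: "inj_on (\<lambda>j. z ^ j) {..<n}"
    by (intro inj_onI) (metis le lessThan_iff order_antisym)
  have "(\<lambda>j. z ^ j) ` {..<n} \<subseteq> {l. l ^ n = 1}"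
    using n(2) by (auto simp flip: power_mult) (metis mult.commute power_mult power_one)
  moreover have "finite {l::'a. l ^ n = 1}" "card {l::'a. l ^ n = 1} \<le> n"
  proof -
    let ?p = "Polynomial.monom 1 n - 1 :: 'a poly"
    have "Polynomial.coeff ?p n = 1"
      using n(1) by simp
    then have "?p \<noteq> 0"
      by (metis coeff_0 zero_neq_one)
    moreover have "Polynomial.degree ?p \<le> n"
      by (intro degree_diff_le) (auto simp: degree_monom_le)
    moreover have "{l. l ^ n = 1} = {l. poly ?p l = 0}"
      by (simp add: poly_monom)
    ultimately show "finite {l::'a. l ^ n = 1}" "card {l::'a. l ^ n = 1} \<le> n"
      using poly_roots_finite[of ?p] card_poly_roots_bound[of ?p] by auto
  qed
  ultimately show "{l. l ^ n = 1} = (\<lambda>j. z ^ j) ` {..<n}"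
    using card_image[OF inj] by (metis card_lessThan card_seteq)
qed

section \<open>Polynomials with a single root\<close>

lemma carrier_eigengroup_single_root:
  fixes \<nu> :: "'a::field"
  assumes "0 < d"
  shows "carrier (eigengroup ([:- \<nu>, 1:] ^ d)) = {aff_sigma l ((1 - l) * \<nu>) | l. l \<noteq> 0}"
proof -
  have "m = (1 - l) * \<nu>" if "aff_sigma l m ([:- \<nu>, 1:] ^ d) = smult c ([:- \<nu>, 1:] ^ d)" for l m c
  proof -
    \<comment> \<open>Evaluation at \<nu> makes the right-hand side of the eigen-equation vanish, so
      x -> l x + m fixes \<nu>.\<close>
    have "(l * \<nu> + m - \<nu>) ^ d = 0"
      using arg_cong[OF that, of "\<lambda>p. poly p \<nu>"] \<open>0 < d\<close>
      by (simp add: aff_sigma_def poly_pcompose poly_power algebra_simps)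
    then show ?thesis
      by (simp add: algebra_simps)
  qed
  then show ?thesis
    unfolding carrier_eigengroup using aff_sigma_about_power by blast
qed

lemma group_eigengroup: "group (eigengroup f)"
  using group.subgroup_imp_group[OF group_Aut_poly subgroup_eigengroup[of f]]
  by (simp add: eigengroup_def)

lemma eigengroup_single_root_iso:
  fixes \<nu> :: "'a::field"
  assumes "0 < d"
  shows "\<exists>\<phi> \<in> iso (eigengroup ([:- \<nu>, 1:] ^ d)) mult_group.
    \<forall>l. l \<noteq> 0 \<longrightarrow> \<phi> (aff_sigma l ((1 - l) * \<nu>)) = l"
proof
  let ?G = "eigengroup ([:- \<nu>, 1:] ^ d)"
  \<comment> \<open>The ratio of a homothety is read off as the coefficient of x in the image of
    x.\<close>
  let ?\<phi> = "\<lambda>\<sigma> :: 'a poly \<Rightarrow> 'a poly. Polynomial.coeff (\<sigma> [:0, 1:]) (Suc 0)"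
  have \<phi>: "?\<phi> (aff_sigma l m) = l" for l m
    by (simp add: aff_sigma_X)
  have mult: "\<sigma> \<otimes>\<^bsub>?G\<^esub> \<tau> = \<sigma> \<circ> \<tau>" for \<sigma> \<tau>
    by (simp add: eigengroup_def Aut_poly_def)
  have K: "carrier (mult_group :: 'a monoid) = - {0}" "x \<otimes>\<^bsub>mult_group\<^esub> y = x * y" for x y :: 'a
    by (auto simp: ring_of_type_algebra_def)
  have "bij_betw ?\<phi> (carrier ?G) (carrier mult_group)"
    unfolding carrier_eigengroup_single_root[OF assms] K
    by (rule bij_betw_byWitness[where f' = "\<lambda>l. aff_sigma l ((1 - l) * \<nu>)"]) (auto simp: \<phi>)
  moreover have "?\<phi> \<in> hom ?G mult_group"
    by (rule homI)
      (auto simp: carrier_eigengroup_single_root[OF assms] K mult \<phi> aff_sigma_comp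
        simp del: carrier_mult_of mult_mult_of comp_apply)
  ultimately show "?\<phi> \<in> iso ?G mult_group"
    by (simp add: iso_def)
  show "\<forall>l. l \<noteq> 0 \<longrightarrow> ?\<phi> (aff_sigma l ((1 - l) * \<nu>)) = l"
    using \<phi> by blast
qed

section \<open>Polynomials with at least two roots\<close>

lemma carrier_eigengroup_eigenform:
  fixes f :: "'a::field_char_0 poly"
  assumes monic: "Polynomial.lead_coeff f = 1"
    and ef: "is_eigenform f \<nu> s n g"
    and ab: "a \<noteq> b" "poly f a = 0" "poly f b = 0"
  shows "0 < n" and "carrier (eigengroup f) = {aff_sigma l ((1 - l) * \<nu>) | l. l ^ n = 1}"
proof -
  have "f \<noteq> 0"
    using monic by auto
  have "\<not> (\<exists>\<nu>'. f = [:- \<nu>', 1:] ^ Polynomial.degree f)"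
  proof
    assume "\<exists>\<nu>'. f = [:- \<nu>', 1:] ^ Polynomial.degree f"
    then obtain \<nu>' k where "f = [:- \<nu>', 1:] ^ k"
      by blast
    with ab show False
      by (auto simp: poly_power)
  qed
  note ef' = ef[unfolded is_eigenform_def if_not_P[OF this]]
  have \<nu>: "\<nu> = - Polynomial.coeff f (Polynomial.degree f - 1) / of_nat (Polynomial.degree f)"
    and s: "s = Polynomial.order \<nu> f"
    and n: "n = exponent_gcd (pcompose f [:\<nu>, 1:] div [:0, 1:] ^ s)"
    and f: "f = [:- \<nu>, 1:] ^ s * pcompose g ([:- \<nu>, 1:] ^ n)"
    using ef' by blast+
  \<comment> \<open>For n = 0 the eigenform would be (x - \<nu>)^s times the constant g(1), leaving
    \<nu> as the only possible root.\<close>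
  show "0 < n"
  proof (rule ccontr)
    assume "\<not> 0 < n"
    then have p: "poly f x = (x - \<nu>) ^ s * poly g 1" for x
      by (subst f) (simp add: poly_power poly_pcompose)
    then have "poly g 1 \<noteq> 0"
      using \<open>f \<noteq> 0\<close> by (metis mult_zero_right poly_all_0_iff_0)
    then show False
      using ab p by auto
  qed
  have deg: "0 < Polynomial.degree f"
    using ab \<open>f \<noteq> 0\<close> by (auto intro!: gr0I elim!: degree_eq_zeroE)
  define q where "q = pcompose g ([:- \<nu>, 1:] ^ n)"
  define h where "h = pcompose q [:\<nu>, 1:]"
  have f_q: "f = [:- \<nu>, 1:] ^ s * q"
    using f by (simp add: q_def)
  then have F: "pcompose f [:\<nu>, 1:] = [:0, 1:] ^ s * h"
    by (simp add: h_def pcompose_mult pcompose_power' pcompose_pCons)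
  \<comment> \<open>The division by x^s in \<open>is_eigenform\<close> is exact, with quotient
    \<open>h\<close>.\<close>
  have n_h: "n = exponent_gcd h"
    unfolding n F by simp
  \<comment> \<open>The exponent s is the full multiplicity of \<nu> in f, so h(0) = q(\<nu>) does
    not vanish.\<close>
  have "\<not> [:- \<nu>, 1:] dvd q"
  proof
    assume "[:- \<nu>, 1:] dvd q"
    then have "[:- \<nu>, 1:] ^ Suc s dvd f"
      unfolding f_q power_Suc2 by (intro mult_dvd_mono) auto
    then show False
      using order_2[OF \<open>f \<noteq> 0\<close>, of \<nu>] s by simp
  qed
  then have h0: "Polynomial.coeff h 0 \<noteq> 0"
    by (simp add: h_def poly_pcompose poly_eq_0_iff_dvd flip: poly_0_coeff_0)
  have "m = (1 - l) * \<nu> \<and> l ^ n = 1" if "l \<noteq> 0" and eigen: "aff_sigma l m f = smult c f" for l m c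
  proof
    show m: "m = (1 - l) * \<nu>"
      using aff_sigma_eigen_fixes[OF \<open>l \<noteq> 0\<close> deg eigen] monic \<nu> by simp
    have "pcompose ([:0, 1:] ^ s * h) [:0, l:] = smult c ([:0, 1:] ^ s * h)"
      using aff_sigma_about_translate[of l \<nu> f] eigen
      by (simp add: m F pcompose_smult)
    then show "l ^ n = 1"
      unfolding n_h using homothety_eigen_imp_power_exponent_gcd h0 \<open>l \<noteq> 0\<close> by blast
  qed
  \<comment> \<open>Conversely, (x - \<nu>)^n is scaled by \<open>l ^ n\<close>, which is 1, so
    \<open>q\<close>, a polynomial in it, is fixed; only the factor (x - \<nu>)^s contributes to the
    eigenvalue.\<close>
  moreover have "aff_sigma l ((1 - l) * \<nu>) f = smult (l ^ s) f" if "l ^ n = 1" for l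
  proof -
    have "aff_sigma l ((1 - l) * \<nu>) q = q"
      using aff_sigma_about_power[of l \<nu> n] that
      by (simp add: q_def aff_sigma_def flip: pcompose_assoc)
    then have "aff_sigma l ((1 - l) * \<nu>) ([:- \<nu>, 1:] ^ s * q) = smult (l ^ s) ([:- \<nu>, 1:] ^ s * q)"
      using aff_sigma_about_power[of l \<nu> s]
      by (simp add: aff_sigma_def pcompose_mult)
    then show ?thesis
      by (simp flip: f_q)
  qed
  moreover have "l \<noteq> 0" if "l ^ n = 1" for l :: 'a
    using that \<open>0 < n\<close> by (auto simp: power_0_left)
  ultimately have "l \<noteq> 0 \<and> (\<exists>c. aff_sigma l m f = smult c f) \<longleftrightarrow> m = (1 - l) * \<nu> \<and> l ^ n = 1" for l m
    by metis
  then show "carrier (eigengroup f) = {aff_sigma l ((1 - l) * \<nu>) | l. l ^ n = 1}"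
    unfolding carrier_eigengroup by simp
qed

text \<open>Taking the ratio identifies the eigengroup with the n-th roots of unity, so its elements
  are the n distinct powers of the homothety of ratio z.\<close>

lemma carrier_eigengroup_powers:
  fixes f :: "'a::field poly"
  assumes carrier: "carrier (eigengroup f) = {aff_sigma l ((1 - l) * \<nu>) | l. l ^ n = 1}"
    and z: "primitive_root_of_unity n z"
  shows "carrier (eigengroup f)
      = (\<lambda>j. aff_sigma z ((1 - z) * \<nu>) [^]\<^bsub>Aut_poly\<^esub> j) ` {..<n}" (is "_ = ?pow ` _")
    and "carrier (eigengroup f) = generate Aut_poly {aff_sigma z ((1 - z) * \<nu>)}"
    and "Coset.order (eigengroup f) = n"
    and "cyclic_group (eigengroup f)"
proof -
  interpret group "Aut_poly :: ('a poly \<Rightarrow> 'a poly) monoid"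
    by (rule group_Aut_poly)
  let ?z = "aff_sigma z ((1 - z) * \<nu>)"
  have "carrier (eigengroup f) = (\<lambda>l. aff_sigma l ((1 - l) * \<nu>)) ` {l. l ^ n = 1}"
    unfolding carrier by blast
  then show eq: "carrier (eigengroup f) = ?pow ` {..<n}"
    by (simp add: roots_of_unity_eq_powers(1)[OF z] aff_sigma_about_pow image_image)
  have "inj_on ?pow {..<n}"
    using roots_of_unity_eq_powers(2)[OF z]
    by (auto simp: inj_on_def aff_sigma_about_pow aff_sigma_inject)
  then show "Coset.order (eigengroup f) = n"
    by (simp add: Coset.order_def eq card_image)
  have "z ^ n = 1"
    using z by (simp add: primitive_root_of_unity_def)
  then have z_in: "?z \<in> carrier (eigengroup f)"
    unfolding carrier by blast
  then have z_Aut: "?z \<in> carrier Aut_poly"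
    using subgroup.subset[OF subgroup_eigengroup] by blast
  have "?pow j \<in> generate Aut_poly {?z}" for j
    unfolding generate_pow[OF z_Aut] by (simp flip: int_pow_int) blast
  then have "carrier (eigengroup f) \<subseteq> generate Aut_poly {?z}"
    unfolding eq by (rule image_subsetI)
  moreover have "generate Aut_poly {?z} \<subseteq> carrier (eigengroup f)"
    using z_in by (intro generate_subgroup_incl subgroup_eigengroup) simp
  ultimately show gen: "carrier (eigengroup f) = generate Aut_poly {?z}"
    by (rule equalityI)
  interpret E: group "eigengroup f"
    by (rule group_eigengroup)
  have E: "eigengroup f = Aut_poly\<lparr>carrier := carrier (eigengroup f)\<rparr>"
    by (simp add: eigengroup_def)
  \<comment> \<open>\<open>cyclic_group\<close> asks for powers formed inside the eigengroup itself;
    generation in a subgroup agrees with generation in the ambient group.\<close>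
  have "generate (eigengroup f) {?z} = generate Aut_poly {?z}"
    using generate_consistent[OF _ subgroup_eigengroup, of "{?z}" f] z_in
    by (subst E) simp
  then have "carrier (eigengroup f) = range (\<lambda>k::int. ?z [^]\<^bsub>eigengroup f\<^esub> k)"
    unfolding gen using E.generate_pow[OF z_in] by (simp add: full_SetCompr_eq)
  then show "cyclic_group (eigengroup f)"
    unfolding E.cyclic_group using z_in by (rule bexI)
qed

text \<open>The root e^{2 pi i/n} becomes an arbitrary primitive root z. Cyclicity and order stand
  outside the quantifier over z, so they do not depend on the existence of such a root.\<close>

theorem theorem1p3:
  fixes f g :: "'a::{alg_closed_field, field_char_0} poly" and \<nu> :: 'a and s n :: nat
  assumes "Polynomial.lead_coeff f = 1" and "1 \<le> Polynomial.degree f"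
    and "is_eigenform f \<nu> s n g"
  shows
    "(f = [:- \<nu>, 1:] ^ Polynomial.degree f \<longrightarrow>
        carrier (eigengroup f) = {aff_sigma l ((1 - l) * \<nu>) | l. l \<noteq> 0} \<and>
        (\<exists>\<phi> \<in> iso (eigengroup f) mult_group. \<forall>l. l \<noteq> 0 \<longrightarrow> \<phi> (aff_sigma l ((1 - l) * \<nu>)) = l)) \<and>
     ((\<exists>a b. a \<noteq> b \<and> poly f a = 0 \<and> poly f b = 0) \<longrightarrow>
        (carrier (eigengroup f) \<noteq> {\<one>\<^bsub>Aut_poly\<^esub>} \<longleftrightarrow> 1 < n) \<and>
        (1 < n \<longrightarrow>
           cyclic_group (eigengroup f) \<and> Coset.order (eigengroup f) = n \<and>
           (\<forall>z. primitive_root_of_unity n z \<longrightarrow>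
              carrier (eigengroup f) = generate Aut_poly {aff_sigma z ((1 - z) * \<nu>)} \<and>
              carrier (eigengroup f) =
                {aff_sigma z ((1 - z) * \<nu>) [^]\<^bsub>Aut_poly\<^esub> j | j :: nat. j \<le> n - 1})))"
proof (intro conjI impI)
  assume single: "f = [:- \<nu>, 1:] ^ Polynomial.degree f"
  from assms(2) have d: "0 < Polynomial.degree f"
    by simp
  show "carrier (eigengroup f) = {aff_sigma l ((1 - l) * \<nu>) | l. l \<noteq> 0}"
    using carrier_eigengroup_single_root[OF d, of \<nu>] by (simp flip: single)
  show "\<exists>\<phi> \<in> iso (eigengroup f) mult_group. \<forall>l. l \<noteq> 0 \<longrightarrow> \<phi> (aff_sigma l ((1 - l) * \<nu>)) = l"
    using eigengroup_single_root_iso[OF d, of \<nu>] by (simp flip: single)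
next
  assume "\<exists>a b. a \<noteq> b \<and> poly f a = 0 \<and> poly f b = 0"
  then obtain a b where ab: "a \<noteq> b" "poly f a = 0" "poly f b = 0"
    by blast
  note n_pos = carrier_eigengroup_eigenform(1)[OF assms(1,3) ab]
  note carrier = carrier_eigengroup_eigenform(2)[OF assms(1,3) ab]
  \<comment> \<open>Algebraic closedness supplies a primitive root, from which the order and
    cyclicity are derived.\<close>
  obtain z0 :: 'a where z0: "primitive_root_of_unity n z0"
    using primitive_root_of_unity_exists[OF n_pos] by blast
  have card: "card (carrier (eigengroup f)) = n"
    using carrier_eigengroup_powers(3)[OF carrier z0] by (simp add: Coset.order_def)
  have one: "\<one>\<^bsub>Aut_poly\<^esub> \<in> carrier (eigengroup f)"
    using subgroup.one_closed[OF subgroup_eigengroup] .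
  show "carrier (eigengroup f) \<noteq> {\<one>\<^bsub>Aut_poly\<^esub>} \<longleftrightarrow> 1 < n"
  proof -
    have "carrier (eigengroup f) = {\<one>\<^bsub>Aut_poly\<^esub>} \<longleftrightarrow> n = 1"
      using card one by (metis card_1_singletonE is_singletonI is_singleton_altdef singletonD)
    then show ?thesis
      using n_pos by linarith
  qed
  show "cyclic_group (eigengroup f)" "Coset.order (eigengroup f) = n"
    using carrier_eigengroup_powers(3,4)[OF carrier z0] by auto
  show "\<forall>z. primitive_root_of_unity n z \<longrightarrow>
      carrier (eigengroup f) = generate Aut_poly {aff_sigma z ((1 - z) * \<nu>)} \<and>
      carrier (eigengroup f) =
        {aff_sigma z ((1 - z) * \<nu>) [^]\<^bsub>Aut_poly\<^esub> j | j :: nat. j \<le> n - 1}"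
  proof (intro allI impI conjI)
    fix z :: 'a
    assume z: "primitive_root_of_unity n z"
    show "carrier (eigengroup f) = generate Aut_poly {aff_sigma z ((1 - z) * \<nu>)}"
      by (rule carrier_eigengroup_powers(2)[OF carrier z])
    \<comment> \<open>The subtraction is truncated, so this relies on n being positive.\<close>
    have "j \<le> n - 1 \<longleftrightarrow> j < n" for j
      using n_pos by linarith
    then show "carrier (eigengroup f) =
        {aff_sigma z ((1 - z) * \<nu>) [^]\<^bsub>Aut_poly\<^esub> j | j :: nat. j \<le> n - 1}"
      using carrier_eigengroup_powers(1)[OF carrier z] by auto
  qed
qed

end
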